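(* Let $\Gamma$ be a connected, interior reduced labeled oriented tree (LOT) with $m$ vertices. Then $$\operatorname{cp}(\Gamma)=\frac{m+1}{2}$$ if and only if $\Gamma$ is decomposable as $$\Gamma=\Gamma_1\sqcup\cdots\sqcup\Gamma_s$$ such that every $\Gamma_i$ is a Rosebrock LOT.
   Context: A labeled oriented tree (LOT) $\Gamma$ is a finite oriented graph with vertex set $V(\Gamma)$ and edge set $E(\Gamma)$ whose underlying undirected graph is a tree, together with a labeling function $l: E(\Gamma)\to V(\Gamma)$. It is interior reduced if for every edge $e$ with endpoints $x,y$ one has $l(e)\notin\{x,y\}$. For $S\subseteq V(\Gamma)$, the set $T_S\subseteq V(\Gamma)$ of vertices reachable from $S$ is the smallest set such that (1) $S\subseteq T_S$, and (2) if $e$ is an edge with endpoints $x$ and $y$ (in either orientation) and both $y\in T_S$ and $l(e)\in T_S$, then $x\in T_S$. One says that $\Gamma$ is reachable from $S$ if $T_S=V(\Gamma)$. The complexity $\operatorname{cp}(\Gamma)$ is the minimum of $|S|$ over all $S\subseteq V(\Gamma)$ such that $\Gamma$ is reachable from $S$. Decomposition: a LOT $\Gamma$ is decomposable into LOTs $\Gamma_1,\Gamma_2$, written $\Gamma=\Gamma_1\sqcup\Gamma_2$, if $\Gamma_1$ and $\Gamma_2$ have distinct vertices and labels and $\Gamma$ is obtained by identifying one vertex of $\Gamma_1$ with one vertex of $\Gamma_2$ (the labels being identified accordingly). More generally, $\Gamma=\Gamma_1\sqcup\cdots\sqcup\Gamma_s$ means that $\Gamma$ can be successively decomposed in this sense,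 $\Gamma=(\cdots((\Gamma_1\sqcup\Gamma_2)\sqcup\Gamma_3)\cdots)\sqcup\Gamma_s$; for $s=1$ it means $\Gamma=\Gamma_1$. A Rosebrock LOT is a LOT with exactly three vertices $a,b,c$ and two edges, one joining $a$ and $b$ with label $c$, and one joining $b$ and $c$ with label $a$ (edge orientations arbitrary).
   Formalization: The assumption m > 1 is added: the one-vertex LOT has cp = 1 = (m+1)/2 but is not a sum of s ≥ 1 Rosebrock LOTs, so the equivalence fails for m = 1. *)

theory Defs
  imports Complex_Main "Graph_Theory.Digraph_Component"
begin

record ('v, 'e) labeled_graph = "('v, 'e) pre_digraph" +
  label :: "'e \<Rightarrow> 'v"

abbreviation digraph_of :: "('v, 'e) labeled_graph \<Rightarrow> ('v, 'e) pre_digraph" where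
  "digraph_of G \<equiv> pre_digraph.truncate G"

definition joins :: "('v, 'e) labeled_graph \<Rightarrow> 'e \<Rightarrow> 'v \<Rightarrow> 'v \<Rightarrow> bool" where
  "joins G e x y \<longleftrightarrow>
     e \<in> arcs G \<and> (tail G e = x \<and> head G e = y \<or> tail G e = y \<and> head G e = x)"

text \<open>The library predicate \<open>tree\<close> excludes only directed cycles, so cycles of the underlying
  undirected multigraph are introduced here. Length 1 is a loop, length 2 a pair of parallel
  edges.\<close>

definition undirected_cycle :: "('v, 'e) labeled_graph \<Rightarrow> 'v list \<Rightarrow> 'e list \<Rightarrow> bool" where
  "undirected_cycle G vs es \<longleftrightarrow>
     vs \<noteq> [] \<and> length es = length vs \<and> distinct vs \<and> distinct es \<and>
     (\<forall>i < length vs. joins G (es ! i) (vs ! i) (vs ! (Suc i mod length vs)))"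

text \<open>The library predicate \<open>connected\<close> refers to the symmetric closure and includes
  nonemptiness of the vertex set.\<close>

definition underlying_tree :: "('v, 'e) labeled_graph \<Rightarrow> bool" where
  "underlying_tree G \<longleftrightarrow>
     connected (digraph_of G) \<and> \<not> (\<exists>vs es. undirected_cycle G vs es)"

definition LOT :: "('v, 'e) labeled_graph \<Rightarrow> bool" where
  "LOT G \<longleftrightarrow>
     fin_digraph (digraph_of G) \<and> underlying_tree G \<and> (\<forall>e \<in> arcs G. label G e \<in> verts G)"

definition interior_reduced :: "('v, 'e) labeled_graph \<Rightarrow> bool" where
  "interior_reduced G \<longleftrightarrow> (\<forall>e \<in> arcs G. label G e \<notin> {tail G e, head G e})"

inductive_set reach_set :: "('v, 'e) labeled_graph \<Rightarrow> 'v set \<Rightarrow> 'v set"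
  for G :: "('v, 'e) labeled_graph" and S :: "'v set" where
  base: "x \<in> S \<Longrightarrow> x \<in> reach_set G S"
| step: "\<lbrakk>joins G e x y; y \<in> reach_set G S; label G e \<in> reach_set G S\<rbrakk> \<Longrightarrow> x \<in> reach_set G S"

definition reachable_from :: "('v, 'e) labeled_graph \<Rightarrow> 'v set \<Rightarrow> bool" where
  "reachable_from G S \<longleftrightarrow> reach_set G S = verts G"

definition cp :: "('v, 'e) labeled_graph \<Rightarrow> nat" where
  "cp G = Min (card ` {S. S \<subseteq> verts G \<and> reachable_from G S})"

definition LOT_iso :: "('v, 'e) labeled_graph \<Rightarrow> ('w, 'f) labeled_graph \<Rightarrow> bool" where
  "LOT_iso G H \<longleftrightarrow>
     (\<exists>f g. bij_betw f (verts G) (verts H) \<and> bij_betw g (arcs G) (arcs H) \<and>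
        (\<forall>e \<in> arcs G. tail H (g e) = f (tail G e) \<and> head H (g e) = f (head G e) \<and>
                      label H (g e) = f (label G e)))"

text \<open>The quotient of the disjoint union of two labeled graphs that identifies the vertex \<open>x\<close> of
  the first with the vertex \<open>y\<close> of the second; the class of the two is represented by \<open>Inl x\<close>.\<close>

definition identify :: "'v \<Rightarrow> 'w \<Rightarrow> 'v + 'w \<Rightarrow> 'v + 'w" where
  "identify x y u = (if u = Inr y then Inl x else u)"

definition glue ::
  "('v, 'e) labeled_graph \<Rightarrow> 'v \<Rightarrow> ('w, 'f) labeled_graph \<Rightarrow> 'w \<Rightarrow> ('v + 'w, 'e + 'f) labeled_graph"
where
  "glue G x H y =
     \<lparr>verts = identify x y ` (verts G <+> verts H),
      arcs = arcs G <+> arcs H,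
      tail = identify x y \<circ> map_sum (tail G) (tail H),
      head = identify x y \<circ> map_sum (head G) (head H),
      label = identify x y \<circ> map_sum (label G) (label H)\<rparr>"

text \<open>A gluing of LOTs is meant up to isomorphism. The factors may be taken over the same types
  as the whole, because each factor embeds into the whole.\<close>

definition is_sum ::
  "('v, 'e) labeled_graph \<Rightarrow> ('v, 'e) labeled_graph \<Rightarrow> ('v, 'e) labeled_graph \<Rightarrow> bool"
where
  "is_sum G G1 G2 \<longleftrightarrow>
     LOT G1 \<and> LOT G2 \<and> (\<exists>x \<in> verts G1. \<exists>y \<in> verts G2. LOT_iso G (glue G1 x G2 y))"

inductive decomposes :: "('v, 'e) labeled_graph \<Rightarrow> ('v, 'e) labeled_graph list \<Rightarrow> bool" where
  single: "LOT G \<Longrightarrow> decomposes G [G]"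
| snoc: "\<lbrakk>is_sum G G' H; decomposes G' Gs\<rbrakk> \<Longrightarrow> decomposes G (Gs @ [H])"

definition Rosebrock :: "('v, 'e) labeled_graph \<Rightarrow> bool" where
  "Rosebrock G \<longleftrightarrow> LOT G \<and>
     (\<exists>a b c e f. distinct [a, b, c] \<and> verts G = {a, b, c} \<and> e \<noteq> f \<and> arcs G = {e, f} \<and>
        joins G e a b \<and> label G e = c \<and> joins G f b c \<and> label G f = a)"

end

theory Submission
  imports Defs
begin

text \<open>
  If the reachable set of a nonempty \<open>S\<close> is not everything, an edge leaving it has its label outside;
  adding that label to \<open>S\<close> gains at least two vertices. Hence \<open>2 cp \<le> m + 1\<close>, and equality forces
  every nonempty \<open>S\<close> to reach fewer than \<open>2 |S|\<close> vertices. In particular the triple formed by the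
  endpoints and the label of an edge is closed under reachability. Looking at the last step of a
  greedy exhaustion, one finds a Rosebrock triple attached to the rest of the tree at a single
  vertex. Contracting it preserves the hypotheses, so by induction the contraction decomposes, and
  closedness of triples shows that no other edge is labeled by a contracted vertex: the triple splits
  off as a summand. Conversely, a generating set of a sum restricts to generating sets of the
  summands at the cost of adding the identified vertex on one side, which gives \<open>2 cp \<ge> m + 1\<close> for
  sums of Rosebrock LOTs.
\<close>

section \<open>Trees and reachability\<close>

text \<open>Connectedness is traded for a cut condition: a nonempty vertex set closed under
  adjacency is everything. It follows by induction along a walk; conversely it is applied to the set
  of vertices reachable from a given one. Later proofs use only this form.\<close>

lemma LOT_iff:
  "LOT G \<longleftrightarrow>
     finite (verts G) \<and> finite (arcs G) \<and>
     (\<forall>e \<in> arcs G. tail G e \<in> verts G \<and> head G e \<in> verts G \<and> label G e \<in> verts G) \<and>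
     verts G \<noteq> {} \<and>
     (\<forall>U \<subseteq> verts G. U \<noteq> {} \<longrightarrow> (\<forall>e x y. joins G e x y \<longrightarrow> x \<in> U \<longrightarrow> y \<in> U) \<longrightarrow> U = verts G) \<and>
     \<not> (\<exists>vs es. undirected_cycle G vs es)"
proof -
  let ?H = "digraph_of G"
  have sel [simp]: "verts ?H = verts G" "arcs ?H = arcs G" "tail ?H = tail G" "head ?H = head G"
    by (simp_all add: pre_digraph.truncate_def)
  have fin: "fin_digraph ?H \<longleftrightarrow> finite (verts G) \<and> finite (arcs G) \<and>
      (\<forall>e \<in> arcs G. tail G e \<in> verts G \<and> head G e \<in> verts G)"
    by (auto simp: fin_digraph_def wf_digraph_def fin_digraph_axioms_def)
  have ends: "arcs_ends (with_proj (mk_symmetric ?H)) = {(x, y). \<exists>e. joins G e x y}"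
    by (auto simp: arcs_ends_conv parcs_mk_symmetric joins_def)
  have con: "connected ?H \<longleftrightarrow> verts G \<noteq> {} \<and>
      (\<forall>U \<subseteq> verts G. U \<noteq> {} \<longrightarrow> (\<forall>e x y. joins G e x y \<longrightarrow> x \<in> U \<longrightarrow> y \<in> U) \<longrightarrow> U = verts G)"
    if wf: "\<forall>e \<in> arcs G. tail G e \<in> verts G \<and> head G e \<in> verts G"
  proof -
    let ?R = "rtrancl_on (verts G) {(x, y). \<exists>e. joins G e x y}"
    have 1: "connected ?H \<longleftrightarrow> verts G \<noteq> {} \<and> (\<forall>u \<in> verts G. \<forall>v \<in> verts G. (u, v) \<in> ?R)"
      using ends by (simp add: connected_def strongly_connected_def reachable_def)
    have 2: "U = verts G" if "\<forall>u \<in> verts G. \<forall>v \<in> verts G. (u, v) \<in> ?R" "U \<subseteq> verts G" "U \<noteq> {}"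
      and cl: "\<forall>e x y. joins G e x y \<longrightarrow> x \<in> U \<longrightarrow> y \<in> U" for U
    proof -
      obtain u where u: "u \<in> U" using \<open>U \<noteq> {}\<close> by blast
      have "v \<in> U" if "(u, v) \<in> ?R" for v
        using that by (induction rule: rtrancl_on_induct) (use u cl in auto)
      with that u show ?thesis by blast
    qed
    have 3: "(u, v) \<in> ?R" if *: "\<forall>U \<subseteq> verts G. U \<noteq> {} \<longrightarrow>
        (\<forall>e x y. joins G e x y \<longrightarrow> x \<in> U \<longrightarrow> y \<in> U) \<longrightarrow> U = verts G"
      and "u \<in> verts G" "v \<in> verts G" for u v
    proof -
      let ?U = "{w \<in> verts G. (u, w) \<in> ?R}"
      have "y \<in> ?U" if "joins G e x y" "x \<in> ?U" for e x y
        using that wf by (auto simp: joins_def intro!: rtrancl_on_into_rtrancl_on[of u x])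
      moreover have "u \<in> ?U" using that by simp
      ultimately have "?U = verts G" using *[rule_format, of ?U] by blast
      then show ?thesis using that by blast
    qed
    show ?thesis unfolding 1
      by (intro conj_cong refl iffI allI ballI impI; (elim 2; assumption | rule 3; assumption))
  qed
  show ?thesis
  \<comment> \<open>The equivalence \<open>con\<close> is available only when all arcs end in
    vertices; when they do not, both sides are false.\<close>
  proof (cases "\<forall>e \<in> arcs G. tail G e \<in> verts G \<and> head G e \<in> verts G")
    case True
    then show ?thesis unfolding LOT_def underlying_tree_def fin con[OF True] by (simp add: ball_conj_distrib conj_ac)
  next
    case False
    then show ?thesis unfolding LOT_def fin by (auto simp only: ball_conj_distrib)
  qed
qed

lemma LOT_finite: "LOT G \<Longrightarrow> finite (verts G)"
  and LOT_label: "LOT G \<Longrightarrow> e \<in> arcs G \<Longrightarrow> label G e \<in> verts G"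
  and LOT_nonempty: "LOT G \<Longrightarrow> verts G \<noteq> {}"
  and LOT_acyclic: "LOT G \<Longrightarrow> \<not> undirected_cycle G vs es"
  by (simp_all add: LOT_iff)

lemma joins_sym: "joins G e x y \<Longrightarrow> joins G e y x"
  and joins_arc: "joins G e x y \<Longrightarrow> e \<in> arcs G"
  by (auto simp: joins_def)

lemma LOT_joins_verts: "LOT G \<Longrightarrow> joins G e x y \<Longrightarrow> x \<in> verts G \<and> y \<in> verts G"
  unfolding LOT_iff joins_def by blast

lemma LOT_joins_neq:
  assumes "LOT G" "joins G e x y" shows "x \<noteq> y"
proof
  assume "x = y"
  then have "undirected_cycle G [x] [e]" using assms(2) by (simp add: undirected_cycle_def)
  then show False using LOT_acyclic[OF assms(1)] by blast
qed

lemma LOT_joins_unique: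
  assumes "LOT G" "joins G e x y" "joins G f x y" shows "e = f"
proof (rule ccontr)
  assume "e \<noteq> f"
  then have "undirected_cycle G [x, y] [e, f]"
    using assms joins_sym LOT_joins_neq[OF assms(1,2)]
    by (auto simp: undirected_cycle_def less_Suc_eq)
  then show False using LOT_acyclic[OF assms(1)] by blast
qed

lemma LOT_no_triangle:
  assumes "LOT G" "joins G e x y" "joins G f y z" "joins G g z x" shows False
proof -
  have ne: "x \<noteq> y" "y \<noteq> z" "z \<noteq> x" using LOT_joins_neq[OF assms(1)] assms by auto
  have "e \<noteq> f" "f \<noteq> g" "g \<noteq> e" using assms(2-4) ne unfolding joins_def by metis+
  then have "undirected_cycle G [x, y, z] [e, f, g]"
    using assms(2-4) ne by (simp add: undirected_cycle_def less_Suc_eq all_conj_distrib imp_conjL)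
  then show False using LOT_acyclic[OF assms(1)] by blast
qed

lemma LOT_cut:
  assumes "LOT G" "U \<subseteq> verts G" "U \<noteq> {}" "\<And>e x y. joins G e x y \<Longrightarrow> x \<in> U \<Longrightarrow> y \<in> U"
  shows "U = verts G"
proof -
  have "\<forall>U \<subseteq> verts G. U \<noteq> {} \<longrightarrow> (\<forall>e x y. joins G e x y \<longrightarrow> x \<in> U \<longrightarrow> y \<in> U) \<longrightarrow> U = verts G"
    using assms(1) unfolding LOT_iff by (elim conjE)
  then show ?thesis using assms(2-4) by simp
qed

lemma undirected_cycle_mono:
  assumes "undirected_cycle H vs es" "\<And>e x y. joins H e x y \<Longrightarrow> joins G e x y"
  shows "undirected_cycle G vs es"
  using assms by (auto simp: undirected_cycle_def)

lemma interior_reduced_joins: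
  "interior_reduced G \<Longrightarrow> joins G e x y \<Longrightarrow> label G e \<noteq> x \<and> label G e \<noteq> y"
  by (auto simp: interior_reduced_def joins_def)

section \<open>Reachable sets and their greedy extension\<close>

lemma reach_set_least:
  assumes "S \<subseteq> C" "\<And>e x y. joins G e x y \<Longrightarrow> y \<in> C \<Longrightarrow> label G e \<in> C \<Longrightarrow> x \<in> C"
  shows "reach_set G S \<subseteq> C"
proof
  fix x assume "x \<in> reach_set G S"
  then show "x \<in> C"
  proof induction
    case (base x) then show ?case using assms(1) by blast
  next
    case (step e x y) then show ?case using assms(2) by simp
  qed
qed

lemma reach_set_mono: "S \<subseteq> reach_set G S' \<Longrightarrow> reach_set G S \<subseteq> reach_set G S'"
  by (rule reach_set_least) (auto elim: reach_set.step)

lemma reach_set_base: "S \<subseteq> reach_set G S"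
  by (auto intro: reach_set.base)

lemma reach_set_verts: "LOT G \<Longrightarrow> S \<subseteq> verts G \<Longrightarrow> reach_set G S \<subseteq> verts G"
  by (rule reach_set_least) (auto dest: LOT_joins_verts)

text \<open>A step needs an endpoint and a label already reached, and interior reducedness makes
  these two distinct vertices; a set with at most one element offers no such pair.\<close>

lemma reach_set_small:
  assumes "interior_reduced G" "card S \<le> 1" "finite S"
  shows "reach_set G S \<subseteq> S"
proof (rule reach_set_least)
  show "x \<in> S" if "joins G e x y" "y \<in> S" "label G e \<in> S" for e x y
    using interior_reduced_joins[OF assms(1) that(1)] that(2,3) assms(2,3)
      card_mono[of S "{y, label G e}"] by auto
qed simp

text \<open>Connectedness supplies an edge leaving the reachable set. Its label is outside, since
  otherwise the edge could be crossed; once the label is added, it can be. One new generator thus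
  gains two vertices, distinct by interior reducedness.\<close>

lemma LOT_extend:
  assumes G: "LOT G" "interior_reduced G" and S: "S \<subseteq> verts G" "S \<noteq> {}" "reach_set G S \<noteq> verts G"
  obtains e x y where "joins G e x y" "y \<in> reach_set G S" "x \<notin> reach_set G S"
    "label G e \<notin> reach_set G S" "x \<noteq> label G e"
    "insert x (insert (label G e) (reach_set G S)) \<subseteq> reach_set G (insert (label G e) S)"
proof -
  have "\<exists>e x y. joins G e x y \<and> y \<in> reach_set G S \<and> x \<notin> reach_set G S"
  proof (rule ccontr)
    assume "\<not> ?thesis"
    then have "\<forall>e x y. joins G e x y \<longrightarrow> x \<in> reach_set G S \<longrightarrow> y \<in> reach_set G S"
      using joins_sym by metis
    moreover have "reach_set G S \<noteq> {}" using S(2) reach_set_base[of S G] by blast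
    ultimately show False
      using LOT_cut[OF G(1) reach_set_verts[OF G(1) S(1)]] S(3) by blast
  qed
  then obtain e x y where e: "joins G e x y" "y \<in> reach_set G S" "x \<notin> reach_set G S" by blast
  have sub: "insert (label G e) (reach_set G S) \<subseteq> reach_set G (insert (label G e) S)"
    using reach_set_mono[of S G "insert (label G e) S"] reach_set_base[of "insert (label G e) S" G]
    by blast
  then have "x \<in> reach_set G (insert (label G e) S)"
    using e(2) by (intro reach_set.step[OF e(1)]) auto
  moreover have "label G e \<notin> reach_set G S" using e(2,3) reach_set.step[OF e(1)] by blast
  ultimately show thesis
    using that[OF e] sub interior_reduced_joins[OF G(2) e(1)] by auto
qed

text \<open>Each greedy round adds one generator and at least two reached vertices, so twice the
  number of generators minus the number of reached vertices never grows. The inequality compares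
  this quantity at the start and at the end.\<close>

lemma reachable_superset:
  assumes G: "LOT G" "interior_reduced G"
  shows "S \<subseteq> verts G \<Longrightarrow> S \<noteq> {} \<Longrightarrow>
    \<exists>S' \<subseteq> verts G. reachable_from G S' \<and>
      2 * card S' + card (reach_set G S) \<le> card (verts G) + 2 * card S"
proof (induction "card (verts G - reach_set G S)" arbitrary: S rule: less_induct)
  case less
  note fin = LOT_finite[OF G(1)]
  show ?case
  proof (cases "reach_set G S = verts G")
    case True
    then show ?thesis using less.prems by (intro exI[of _ S]) (auto simp: reachable_from_def)
  next
    case False
    obtain e x y where e: "joins G e x y" "y \<in> reach_set G S" "x \<notin> reach_set G S"
      "label G e \<notin> reach_set G S" "x \<noteq> label G e"
      "insert x (insert (label G e) (reach_set G S)) \<subseteq> reach_set G (insert (label G e) S)"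
      using LOT_extend[OF G less.prems False] by metis
    let ?S = "insert (label G e) S"
    have S: "?S \<subseteq> verts G" using less.prems LOT_label[OF G(1) joins_arc[OF e(1)]] by auto
    note rv = reach_set_verts[OF G(1) S] reach_set_verts[OF G(1) less.prems(1)]
    have fr: "finite (reach_set G ?S)" "finite (reach_set G S)" using rv[THEN finite_subset] fin by blast+
    have c: "card (reach_set G S) + 2 \<le> card (reach_set G ?S)"
      using card_mono[OF fr(1) e(6)] e(3-5) fr(2) by simp
    have "verts G - reach_set G ?S \<subset> verts G - reach_set G S"
      using e(3,6) LOT_joins_verts[OF G(1) e(1)] by blast
    then have "card (verts G - reach_set G ?S) < card (verts G - reach_set G S)"
      using fin by (simp add: psubset_card_mono)
    from less.hyps[OF this S]
    obtain S' where S': "S' \<subseteq> verts G" "reachable_from G S'"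
      "2 * card S' + card (reach_set G ?S) \<le> card (verts G) + 2 * card ?S" by blast
    have "label G e \<notin> S" using e(4) reach_set_base[of S G] by blast
    then have "card ?S = Suc (card S)" using finite_subset[OF less.prems(1) fin] by simp
    then show ?thesis using S' c by (intro exI[of _ S']) auto
  qed
qed

lemma cp_le:
  assumes "LOT G" "S \<subseteq> verts G" "reachable_from G S" shows "cp G \<le> card S"
  unfolding cp_def using assms LOT_finite[OF assms(1)] by (intro Min_le) auto

lemma cp_attained:
  assumes "LOT G" obtains S where "S \<subseteq> verts G" "reachable_from G S" "card S = cp G"
proof -
  have "reachable_from G (verts G)"
    using reach_set_verts[OF assms order_refl] reach_set_base[of "verts G" G]
    by (auto simp: reachable_from_def)
  then have "card ` {S. S \<subseteq> verts G \<and> reachable_from G S} \<noteq> {}" by blast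
  from Min_in[OF _ this] show thesis using that LOT_finite[OF assms] by (auto simp: cp_def)
qed

text \<open>The greedy extension is started from a single vertex.\<close>

lemma cp_upper_bound:
  assumes "LOT G" "interior_reduced G" shows "2 * cp G \<le> card (verts G) + 1"
proof -
  obtain v where v: "v \<in> verts G" using LOT_nonempty[OF assms(1)] by blast
  obtain S' where S': "S' \<subseteq> verts G" "reachable_from G S'"
    "2 * card S' + card (reach_set G {v}) \<le> card (verts G) + 2 * card {v}"
    using reachable_superset[OF assms, of "{v}"] v by auto
  have "finite (reach_set G {v})"
    using reach_set_verts[OF assms(1), of "{v}"] LOT_finite[OF assms(1)] v by (auto intro: finite_subset)
  then have "card (reach_set G {v}) \<ge> 1"
    using reach_set_base[of "{v}" G] by (simp add: Suc_le_eq card_gt_0_iff) blast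
  then show ?thesis using S'(3) cp_le[OF assms(1) S'(1,2)] by simp
qed

section \<open>LOTs of maximal complexity\<close>

text \<open>This is what the induction carries instead of maximal complexity: a bound on all
  nonempty \<open>S\<close> passes directly to a contraction.\<close>

definition sparse :: "('v, 'e) labeled_graph \<Rightarrow> bool" where
  "sparse G \<longleftrightarrow> (\<forall>S \<subseteq> verts G. S \<noteq> {} \<longrightarrow> card (reach_set G S) < 2 * card S)"

text \<open>A nonempty set reaching at least twice its size would extend greedily to a generating
  set \<open>S'\<close> with \<open>2 * card S' <= card (verts G)\<close>.\<close>

lemma cp_max_imp_sparse:
  assumes G: "LOT G" "interior_reduced G" and cp: "card (verts G) < 2 * cp G"
  shows "sparse G"
  unfolding sparse_def
proof (intro allI impI)
  fix S assume "S \<subseteq> verts G" "S \<noteq> {}"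
  from reachable_superset[OF G this] obtain S' where S': "S' \<subseteq> verts G" "reachable_from G S'"
      "2 * card S' + card (reach_set G S) \<le> card (verts G) + 2 * card S" by blast
  then show "card (reach_set G S) < 2 * card S" using cp cp_le[OF G(1) S'(1,2)] by simp
qed

text \<open>The two generators \<open>p\<close> and \<open>label G e\<close> already reach
  \<open>q\<close>, and sparseness allows them at most three vertices. So the triple is itself a
  reachable set, hence closed under steps.\<close>

lemma sparse_triple_closed:
  assumes G: "LOT G" "interior_reduced G" "sparse G"
    and e: "joins G e p q" and f: "joins G f u w"
    and u: "u \<in> {p, q, label G e}" "label G f \<in> {p, q, label G e}"
  shows "w \<in> {p, q, label G e}"
proof -
  let ?r = "label G e" let ?C = "reach_set G {p, ?r}"
  have V: "{p, ?r} \<subseteq> verts G" using LOT_joins_verts[OF G(1) e] LOT_label[OF G(1) joins_arc[OF e]] by simp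
  have ne: "p \<noteq> ?r" "q \<noteq> ?r" "p \<noteq> q"
    using interior_reduced_joins[OF G(2) e] LOT_joins_neq[OF G(1) e] by auto
  have fin: "finite ?C" using reach_set_verts[OF G(1) V] LOT_finite[OF G(1)] by (rule finite_subset)
  have "q \<in> ?C" by (rule reach_set.step[OF joins_sym[OF e]]) (auto intro: reach_set.base)
  then have sub: "{p, q, ?r} \<subseteq> ?C" by (auto intro: reach_set.base)
  have "card ?C < 2 * card {p, ?r}" using G(3) V by (auto simp: sparse_def)
  then have "card ?C \<le> card {p, q, ?r}" using ne by simp
  then have C: "{p, q, ?r} = ?C" using card_seteq[OF fin sub] by simp
  then have "u \<in> ?C" "label G f \<in> ?C" using u by auto
  then show ?thesis using reach_set.step[OF joins_sym[OF f]] C by blast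
qed

text \<open>\<open>T\<close> is a largest proper reachable set that wastes no generator. By
  maximality one more greedy step reaches everything, and sparseness then leaves room for only two
  vertices outside \<open>T\<close>.\<close>

lemma sparse_last_step:
  assumes G: "LOT G" "interior_reduced G" "sparse G" and card: "card (verts G) > 1"
  obtains T e x y where "joins G e x y" "y \<in> T" "x \<notin> T" "label G e \<notin> T" "x \<noteq> label G e"
    "verts G = insert x (insert (label G e) T)"
    "\<And>f u w. joins G f u w \<Longrightarrow> w \<in> T \<Longrightarrow> label G f \<in> T \<Longrightarrow> u \<in> T"
proof -
  note fin = LOT_finite[OF G(1)]
  \<comment> \<open>Together with sparseness the last inequality of \<open>?P\<close> is an
    equality. Singletons satisfy it, and every greedy step that does not reach all vertices
    preserves it.\<close>
  let ?P = "\<lambda>S. S \<subseteq> verts G \<and> S \<noteq> {} \<and> reach_set G S \<noteq> verts G \<and> 2 * card S \<le> card (reach_set G S) + 1"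
  obtain v where v: "v \<in> verts G" using LOT_nonempty[OF G(1)] by blast
  have "reach_set G {v} = {v}" using reach_set_small[OF G(2), of "{v}"] reach_set_base[of "{v}" G] by auto
  moreover have "{v} \<noteq> verts G" using card by (metis card_1_singleton_iff less_irrefl One_nat_def)
  ultimately have "?P {v}" using v by simp
  moreover have "\<forall>S. ?P S \<longrightarrow> card (reach_set G S) < Suc (card (verts G))"
    using card_mono[OF fin reach_set_verts[OF G(1)]] by (simp add: less_Suc_eq_le)
  ultimately obtain S where S: "?P S" and max: "\<And>S'. ?P S' \<Longrightarrow> card (reach_set G S') \<le> card (reach_set G S)"
    using ex_has_greatest_nat[of ?P "{v}" "\<lambda>S. card (reach_set G S)" "Suc (card (verts G))"] by (metis (no_types, lifting))
  let ?T = "reach_set G S"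
  obtain e x y where e: "joins G e x y" "y \<in> ?T" "x \<notin> ?T"
      "label G e \<notin> ?T" "x \<noteq> label G e"
      "insert x (insert (label G e) ?T) \<subseteq> reach_set G (insert (label G e) S)"
    using LOT_extend[OF G(1,2)] S by metis
  let ?S = "insert (label G e) S"
  have S': "?S \<subseteq> verts G" using S LOT_label[OF G(1) joins_arc[OF e(1)]] by auto
  have fr: "finite (reach_set G ?S)" "finite ?T"
    using finite_subset[OF reach_set_verts[OF G(1)] fin] S S' by simp_all
  have "label G e \<notin> S" using e(4) reach_set_base[of S G] by blast
  then have cS: "card ?S = Suc (card S)" using S finite_subset[OF _ fin, of S] by simp
  have ci: "card (insert x (insert (label G e) ?T)) = card ?T + 2" using e(3-5) fr(2) by simp
  have c: "card ?T + 2 \<le> card (reach_set G ?S)"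
    using card_mono[OF fr(1) e(6)] ci by simp
  have full: "reach_set G ?S = verts G"
  proof (rule ccontr)
    assume "reach_set G ?S \<noteq> verts G"
    then have "?P ?S" using S' c cS S by auto
    from max[OF this] show False using c by simp
  qed
  have "card (reach_set G ?S) < 2 * card ?S" using G(3) S' by (auto simp: sparse_def)
  then have "card (verts G) \<le> card (insert x (insert (label G e) ?T))" using full cS ci S by simp
  then have "verts G = insert x (insert (label G e) ?T)"
    using card_seteq[OF fin, of "insert x (insert (label G e) ?T)"] e(6) full by simp
  from that[OF e(1-5) this reach_set.step] show thesis .
qed

section \<open>Rosebrock triples attached at one vertex\<close>

text \<open>The triple \<open>x\<close>, \<open>y\<close>, \<open>z\<close> with the edges
  \<open>e\<close>, \<open>f\<close> meets the rest \<open>T\<close> only in \<open>y\<close>. The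
  alternatives for \<open>f\<close> are the Rosebrock paths with middle vertex \<open>x\<close> or
  \<open>y\<close>. Arcs inside \<open>T\<close> may still be labeled \<open>x\<close> or
  \<open>z\<close>; this is excluded only during the induction.\<close>

definition end_block ::
  "('v, 'e) labeled_graph \<Rightarrow> 'v set \<Rightarrow> 'e \<Rightarrow> 'e \<Rightarrow> 'v \<Rightarrow> 'v \<Rightarrow> 'v \<Rightarrow> bool" where
  "end_block G T e f x y z \<longleftrightarrow>
     y \<in> T \<and> x \<notin> T \<and> z \<notin> T \<and> x \<noteq> z \<and> verts G = insert x (insert z T) \<and>
     joins G e x y \<and> label G e = z \<and>
     (joins G f x z \<and> label G f = y \<or> joins G f y z \<and> label G f = x) \<and>
     (\<forall>g \<in> arcs G. g = e \<or> g = f \<or> tail G g \<in> T \<and> head G g \<in> T)"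

text \<open>The last greedy step gives \<open>e\<close>, \<open>x\<close>, \<open>y\<close> and
  \<open>z\<close> as the label of \<open>e\<close>. Closedness of \<open>T\<close> and of triples
  determines all edges not inside \<open>T\<close>, and connectedness forces one at
  \<open>z\<close>.\<close>

lemma sparse_end_block:
  assumes G: "LOT G" "interior_reduced G" "sparse G" and card: "card (verts G) > 1"
  obtains T e f x y z where "end_block G T e f x y z"
proof -
  obtain T e x y where e: "joins G e x y" and T: "y \<in> T" "x \<notin> T" "label G e \<notin> T" "x \<noteq> label G e"
    and V: "verts G = insert x (insert (label G e) T)"
    and closed: "\<And>f u w. joins G f u w \<Longrightarrow> w \<in> T \<Longrightarrow> label G f \<in> T \<Longrightarrow> u \<in> T"
    using sparse_last_step[OF assms] by metis
  define z where "z = label G e"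
  note T = T[folded z_def] and V = V[folded z_def]
  have lab: "label G g \<in> insert x (insert z T)" if "joins G g u w" for g u w
    using LOT_label[OF G(1) joins_arc[OF that]] V by simp
  \<comment> \<open>The label of an edge leaving \<open>T\<close> is \<open>x\<close> or
    \<open>z\<close>, because \<open>T\<close> is closed. Two vertices of the triple of
    \<open>e\<close> then lead to \<open>u\<close>, so \<open>u\<close> is in that triple and must
    be \<open>y\<close>.\<close>
  have out: "u = y \<and> (w = x \<and> g = e \<or> w = z \<and> label G g = x)"
    if g: "joins G g u w" and u: "u \<in> T" and w: "w \<notin> T" for g u w
  proof -
    have l: "label G g \<in> {x, z}" using lab[OF g] closed[OF joins_sym[OF g] u] w by auto
    have wxz: "w \<in> {x, z}" using LOT_joins_verts[OF G(1) g] V w by auto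
    have "u \<in> {x, y, label G e}"
      by (rule sparse_triple_closed[OF G e joins_sym[OF g]]) (use wxz l z_def in auto)
    then have "u = y" using u T z_def by auto
    then show ?thesis
      using interior_reduced_joins[OF G(2) g] l wxz g joins_sym[OF e] LOT_joins_unique[OF G(1)]
      by auto
  qed
  \<comment> \<open>The triple of \<open>g\<close> contains \<open>x\<close> and the label
    \<open>z\<close> of \<open>e\<close>, so crossing \<open>e\<close> puts \<open>y\<close> into
    it; only the label of \<open>g\<close> can be \<open>y\<close>.\<close>
  have xz: "label G g = y" if g: "joins G g x z" for g
  proof -
    have "y \<in> {x, z, label G g}"
      by (rule sparse_triple_closed[OF G g e]) (auto simp: z_def)
    then show ?thesis using T by auto
  qed
  have split: "g = e \<or> joins G g y z \<and> label G g = x \<or> joins G g x z \<and> label G g = y \<or>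
      u \<in> T \<and> w \<in> T" if g: "joins G g u w" for g u w
  proof (cases "u \<in> T"; cases "w \<in> T")
    assume "u \<in> T" "w \<notin> T"
    then show ?thesis using out[OF g] g by auto
  next
    assume "u \<notin> T" "w \<in> T"
    then show ?thesis using out[OF joins_sym[OF g]] joins_sym[OF g] by auto
  next
    assume "u \<notin> T" "w \<notin> T"
    then have "joins G g x z"
      using LOT_joins_verts[OF G(1) g] LOT_joins_neq[OF G(1) g] V g joins_sym[OF g] by auto
    then show ?thesis using xz by blast
  qed simp
  \<comment> \<open>Without such an edge no edge would meet \<open>z\<close>, and \<open>{z}\<close>
    would be a whole component.\<close>
  have "\<exists>f. joins G f x z \<and> label G f = y \<or> joins G f y z \<and> label G f = x"
  proof (rule ccontr)
    assume no: "\<not> ?thesis"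
    have "{z} = verts G"
    proof (rule LOT_cut[OF G(1)])
      fix g u w assume g: "joins G g u w" and "u \<in> {z}"
      then have gz: "joins G g z w" by simp
      then have "g = e" using split[OF gz] no T(3) by blast
      then have "z \<in> {x, y}" using gz e by (auto simp: joins_def)
      then show "w \<in> {z}" using T by auto
    qed (use V in auto)
    then show False using V T by auto
  qed
  then obtain f where f: "joins G f x z \<and> label G f = y \<or> joins G f y z \<and> label G f = x" by blast
  \<comment> \<open>The two shapes cannot occur together: with \<open>e\<close> they would form a
    triangle.\<close>
  have "g = f" if "joins G g y z \<and> label G g = x \<or> joins G g x z \<and> label G g = y" for g
    using that f LOT_joins_unique[OF G(1)] LOT_no_triangle[OF G(1) e] joins_sym[of G _ x z] by blast
  then have "\<forall>g \<in> arcs G. g = e \<or> g = f \<or> tail G g \<in> T \<and> head G g \<in> T"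
    using split[of _ "tail G _" "head G _"] unfolding joins_def[of G _ "tail G _" "head G _"] by blast
  then have "end_block G T e f x y z"
    unfolding end_block_def using T V e f z_def by blast
  then show thesis by (rule that)
qed

section \<open>Contraction of an end block\<close>

text \<open>Labels \<open>x\<close> and \<open>z\<close> are redirected to \<open>y\<close>, so that
  the result is a LOT before it is known that no remaining arc carries them.\<close>

definition contract :: "('v, 'e) labeled_graph \<Rightarrow> 'v set \<Rightarrow> 'v \<Rightarrow> ('v, 'e) labeled_graph" where
  "contract G T y =
     G\<lparr>verts := T, arcs := {g \<in> arcs G. tail G g \<in> T \<and> head G g \<in> T},
       label := \<lambda>g. if label G g \<in> T then label G g else y\<rparr>"

lemma contract_simps [simp]:
  "verts (contract G T y) = T"
  "arcs (contract G T y) = {g \<in> arcs G. tail G g \<in> T \<and> head G g \<in> T}"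
  "tail (contract G T y) = tail G" "head (contract G T y) = head G"
  "label (contract G T y) g = (if label G g \<in> T then label G g else y)"
  by (simp_all add: contract_def)

lemma joins_contract: "joins (contract G T y) g u w \<longleftrightarrow> joins G g u w \<and> u \<in> T \<and> w \<in> T"
  by (auto simp: joins_def)

lemma end_blockD:
  assumes "end_block G T e f x y z"
  shows "y \<in> T" "x \<notin> T" "z \<notin> T" "x \<noteq> z" "verts G = insert x (insert z T)"
    "joins G e x y" "label G e = z"
    "joins G f x z \<and> label G f = y \<or> joins G f y z \<and> label G f = x"
    "joins G g u w \<Longrightarrow> g = e \<or> g = f \<or> u \<in> T \<and> w \<in> T"
proof -
  have "\<forall>g \<in> arcs G. g = e \<or> g = f \<or> tail G g \<in> T \<and> head G g \<in> T"
    using assms unfolding end_block_def by (elim conjE)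
  then show "joins G g u w \<Longrightarrow> g = e \<or> g = f \<or> u \<in> T \<and> w \<in> T"
    unfolding joins_def by metis
qed (use assms in \<open>simp_all only: end_block_def not_False_eq_True\<close>)

lemma end_block_arcs:
  assumes "end_block G T e f x y z"
  shows "e \<noteq> f" "e \<in> arcs G" "f \<in> arcs G"
    "{g \<in> arcs G. tail G g \<in> T \<and> head G g \<in> T} = arcs G - {e, f}"
proof -
  note b = end_blockD[OF assms]
  show "e \<in> arcs G" "f \<in> arcs G" using b(6,8) joins_arc by metis+
  show "e \<noteq> f" using b(1-4,6-8) by metis
  have "\<not> (tail G g \<in> T \<and> head G g \<in> T)" if "g \<in> {e, f}" for g
    using that b(2,3,6,8) unfolding joins_def by auto
  then show "{g \<in> arcs G. tail G g \<in> T \<and> head G g \<in> T} = arcs G - {e, f}"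
    using b(9)[of _ "tail G _" "head G _"] unfolding joins_def[of G _ "tail G _" "head G _"] by blast
qed

text \<open>The edges \<open>e\<close> and \<open>f\<close> meet \<open>T\<close> only in
  \<open>y\<close>. Hence an adjacency-closed \<open>U\<close> in the contraction becomes closed in
  \<open>G\<close> after adding \<open>x\<close> and \<open>z\<close> if it contains
  \<open>y\<close>, and is already closed in \<open>G\<close> otherwise; the latter is impossible as
  \<open>x\<close> is missing.\<close>

lemma LOT_contract:
  assumes G: "LOT G" and b: "end_block G T e f x y z"
  shows "LOT (contract G T y)"
proof -
  note b = end_blockD[OF b]
  have cut: "U = T" if U: "U \<subseteq> T" "U \<noteq> {}"
    and cl: "\<forall>g u w. joins (contract G T y) g u w \<longrightarrow> u \<in> U \<longrightarrow> w \<in> U" for U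
  proof (cases "y \<in> U")
    case True
    have "insert x (insert z U) = verts G"
    proof (rule LOT_cut[OF G])
      fix g u w assume g: "joins G g u w" "u \<in> insert x (insert z U)"
      consider "g = e" | "g = f" | "u \<in> T" "w \<in> T" using b(9)[OF g(1)] by blast
      then show "w \<in> insert x (insert z U)"
      proof cases
        case 3
        then have "u \<in> U" using g(2) b(2,3) by auto
        then show ?thesis using cl g(1) 3 by (auto simp: joins_contract)
      qed (use g(1) b(6,8) True in \<open>auto simp: joins_def\<close>)
    qed (use U b in auto)
    then have "t \<in> U" if "t \<in> T" for t using that b(2,3,5) by (metis insert_iff)
    then show ?thesis using U(1) by blast
  next
    case False
    have "U = verts G"
    proof (rule LOT_cut[OF G])
      fix g u w assume g: "joins G g u w" "u \<in> U"
      have "u \<notin> {x, y, z}" using g(2) U(1) b(2,3) False by auto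
      then have "g \<noteq> e" "g \<noteq> f" using g(1) b(6,8) by (auto simp: joins_def)
      then show "w \<in> U" using b(9)[OF g(1)] cl g by (auto simp: joins_contract)
    qed (use U b in auto)
    then show ?thesis using b(2,5) U(1) by blast
  qed
  have "\<not> undirected_cycle (contract G T y) vs es" for vs es
    using LOT_acyclic[OF G] undirected_cycle_mono[of "contract G T y" vs es G]
    by (auto simp: joins_contract)
  moreover have "finite T" using LOT_finite[OF G] b(5) by simp
  moreover have "finite (arcs G)" using G by (simp add: LOT_iff)
  ultimately show ?thesis unfolding LOT_iff using b(1) cut by simp blast
qed

lemma Rosebrock_end_block:
  assumes G: "LOT G" and b: "end_block G T e f x y z"
  shows "Rosebrock (G\<lparr>verts := {x, y, z}, arcs := {e, f}\<rparr>)" (is "Rosebrock ?R")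
proof -
  note a = end_block_arcs[OF b]
  note b = end_blockD[OF b]
  have j: "joins ?R g u w \<longleftrightarrow> joins G g u w \<and> g \<in> {e, f}" for g u w
    using a by (auto simp: joins_def)
  have cut: "U = {x, y, z}" if U: "U \<subseteq> {x, y, z}" "U \<noteq> {}"
    and cl: "\<forall>g u w. joins ?R g u w \<longrightarrow> u \<in> U \<longrightarrow> w \<in> U" for U
  proof -
    have 1: "x \<in> U \<longleftrightarrow> y \<in> U" using cl b(6) joins_sym[OF b(6)] unfolding j by blast
    have "x \<in> U \<longleftrightarrow> z \<in> U" if "joins G f x z" using cl that joins_sym[OF that] unfolding j by blast
    moreover have "y \<in> U \<longleftrightarrow> z \<in> U" if "joins G f y z"
      using cl that joins_sym[OF that] unfolding j by blast
    ultimately show ?thesis using 1 U b(8) by blast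
  qed
  have "\<not> undirected_cycle ?R vs es" for vs es
    using LOT_acyclic[OF G] undirected_cycle_mono[of ?R vs es G] by (auto simp: j)
  moreover have "\<forall>g \<in> {e, f}. tail G g \<in> {x, y, z} \<and> head G g \<in> {x, y, z} \<and> label G g \<in> {x, y, z}"
    using b(6-8) by (auto simp: joins_def)
  ultimately have LOT: "LOT ?R" unfolding LOT_iff using cut by simp
  have ne: "distinct [y, x, z]" "distinct [x, y, z]" using b(1-4) by auto
  have e: "joins ?R e x y" "joins ?R e y x" using b(6) joins_sym[OF b(6)] j by auto
  show ?thesis
    using b(8)
  proof
    assume "joins G f x z \<and> label G f = y"
    then show ?thesis unfolding Rosebrock_def using LOT ne e a(1) b(7) j
      by (intro conjI exI[of _ y] exI[of _ x] exI[of _ z] exI[of _ e] exI[of _ f]) auto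
  next
    assume "joins G f y z \<and> label G f = x"
    then show ?thesis unfolding Rosebrock_def using LOT ne e a(1) b(7) j
      by (intro conjI exI[of _ x] exI[of _ y] exI[of _ z] exI[of _ e] exI[of _ f]) auto
  qed
qed

text \<open>By \<open>lab\<close> the contraction alters no label, so it is a genuine sub-LOT
  sharing only \<open>y\<close> with the triple.\<close>

lemma is_sum_end_block:
  assumes G: "LOT G" and b: "end_block G T e f x y z"
    and lab: "\<And>g. g \<in> arcs G - {e, f} \<Longrightarrow> label G g \<in> T"
  shows "is_sum G (contract G T y) (G\<lparr>verts := {x, y, z}, arcs := {e, f}\<rparr>)" (is "is_sum G ?H ?R")
proof -
  have R: "LOT ?R" using Rosebrock_end_block[OF G b] by (simp add: Rosebrock_def)
  note a = end_block_arcs[OF b] and H = LOT_contract[OF G b]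
  note b = end_blockD[OF b]
  let ?K = "glue ?H y ?R y"
  \<comment> \<open>The shared vertex \<open>y\<close> goes to the left copy, matching the
    representative chosen by \<open>identify\<close>.\<close>
  let ?\<phi> = "\<lambda>v. if v \<in> T then Inl v else Inr v" and ?\<psi> = "\<lambda>g. if g \<in> {e, f} then Inr g else Inl g"
  have vK: "verts ?K = Inl ` T \<union> {Inr x, Inr z}"
    using b(1-3) by (auto simp: glue_def identify_def image_iff)
  have "bij_betw ?\<phi> (verts G) (verts ?K)"
    unfolding vK b(5) using b(2,3) by (auto simp: bij_betw_def inj_on_def)
  moreover have "arcs ?K = Inl ` (arcs G - {e, f}) \<union> {Inr e, Inr f}"
    using a by (auto simp: glue_def)
  then have "bij_betw ?\<psi> (arcs G) (arcs ?K)"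
    using a(2,3) by (auto simp: bij_betw_def inj_on_def)
  moreover have "tail ?K (?\<psi> g) = ?\<phi> (tail G g) \<and> head ?K (?\<psi> g) = ?\<phi> (head G g) \<and>
      label ?K (?\<psi> g) = ?\<phi> (label G g)" if g: "g \<in> arcs G" for g
  proof (cases "g \<in> {e, f}")
    case True
    have "tail G g \<in> {x, y, z}" "head G g \<in> {x, y, z}" "label G g \<in> {x, y, z}"
      using True b(6-8) by (auto simp: joins_def)
    then show ?thesis using True b(1-3) by (auto simp: glue_def identify_def)
  next
    case False
    then have "tail G g \<in> T" "head G g \<in> T" using a(4) g by auto
    then show ?thesis using False lab[of g] g by (simp add: glue_def identify_def)
  qed
  ultimately have "LOT_iso G ?K" unfolding LOT_iso_def by blast
  then show ?thesis unfolding is_sum_def using H R b(1) by auto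
qed

text \<open>Relabeling does harm only to an edge at \<open>y\<close> labeled \<open>x\<close> or
  \<open>z\<close>. Its other endpoint would lie in the closed triple of \<open>e\<close>, but
  within \<open>T\<close> that triple has only \<open>y\<close>.\<close>

lemma interior_reduced_contract:
  assumes G: "LOT G" "interior_reduced G" "sparse G" and b: "end_block G T e f x y z"
  shows "interior_reduced (contract G T y)"
proof -
  note b = end_blockD[OF b]
  have no: "label G g \<in> T" if g: "joins G g y q" "q \<in> T" for g q
  proof (rule ccontr)
    assume "label G g \<notin> T"
    then have "label G g \<in> {x, z}" using LOT_label[OF G(1) joins_arc[OF g(1)]] b(5) by simp
    then have "q \<in> {x, y, label G e}"
      by (intro sparse_triple_closed[OF G b(6) g(1)]) (auto simp: b(7))
    then show False using g(2) b(2,3,7) LOT_joins_neq[OF G(1) g(1)] by auto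
  qed
  show ?thesis
    unfolding interior_reduced_def
  proof
    fix g assume "g \<in> arcs (contract G T y)"
    then have g: "joins G g (tail G g) (head G g)" "tail G g \<in> T" "head G g \<in> T"
      by (auto simp: joins_def)
    show "label (contract G T y) g \<notin> {tail (contract G T y) g, head (contract G T y) g}"
      using interior_reduced_joins[OF G(2) g(1)] no[of g "head G g"] no[of g "tail G g"]
        g joins_sym[OF g(1)] by auto
  qed
qed

lemma sparse_contract:
  assumes G: "LOT G" "sparse G" and b: "end_block G T e f x y z"
  shows "sparse (contract G T y)"
  unfolding sparse_def
proof (intro allI impI)
  note H = LOT_contract[OF G(1) b]
  note b = end_blockD[OF b]
  let ?H = "contract G T y"
  fix S assume S: "S \<subseteq> verts ?H" "S \<noteq> {}"
  have SG: "S \<subseteq> verts G" "insert z S \<subseteq> verts G" using S b(5) by auto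
  have RT: "reach_set ?H S \<subseteq> T" using reach_set_verts[OF H S(1)] by simp
  have finT: "finite T" using LOT_finite[OF H] by simp
  have finS: "finite S" using S finT finite_subset by auto
  have finR: "finite (reach_set G A)" if "A \<subseteq> verts G" for A
    using finite_subset[OF reach_set_verts[OF G(1) that] LOT_finite[OF G(1)]] .
  have labG: "label G g \<in> insert x (insert z T)" if "joins G g u w" for g u w
    using LOT_label[OF G(1) joins_arc[OF that]] b(5) by simp
  show "card (reach_set ?H S) < 2 * card S"
  proof (cases "y \<in> reach_set ?H S")
    case True
    \<comment> \<open>The extra generator \<open>z\<close> makes \<open>x\<close> reachable as soon
      as \<open>y\<close> is, so every relabeled edge usable in the contraction is usable in
      \<open>G\<close>. One generator is paid for the two further vertices \<open>x\<close> and
      \<open>z\<close>.\<close>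
    let ?C = "reach_set G (insert z S)"
    have z: "z \<in> ?C" by (auto intro: reach_set.base)
    have yx: "x \<in> ?C" if "y \<in> ?C" using reach_set.step[OF b(6) that] z b(7) by simp
    have sub: "reach_set ?H S \<subseteq> ?C"
    proof (rule reach_set_least)
      show "S \<subseteq> ?C" by (auto intro: reach_set.base)
      fix g u w assume g: "joins ?H g u w" "w \<in> ?C" "label ?H g \<in> ?C"
      have gG: "joins G g u w" using g(1) by (simp add: joins_contract)
      have "label G g \<in> ?C" using g(3) labG[OF gG] z yx by (auto split: if_splits)
      then show "u \<in> ?C" using reach_set.step[OF gG g(2)] by simp
    qed
    have "insert x (insert z (reach_set ?H S)) \<subseteq> ?C" using sub True z yx by auto
    from card_mono[OF finR[OF SG(2)] this] have "card (reach_set ?H S) + 2 \<le> card ?C"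
      using contra_subsetD[OF RT b(2)] contra_subsetD[OF RT b(3)] b(4) finite_subset[OF RT finT] by simp
    moreover have "card ?C < 2 * card (insert z S)" using G(2) SG(2) by (auto simp: sparse_def)
    moreover have "card (insert z S) \<le> Suc (card S)" by (rule card_insert_le_m1) auto
    ultimately show ?thesis by simp
  next
    case False
    \<comment> \<open>The intersection records that labels met so far are reached in the
      contraction, hence differ from \<open>y\<close>; no relabeled edge is ever used.\<close>
    let ?C = "reach_set G S \<inter> reach_set ?H S"
    have "reach_set ?H S \<subseteq> ?C"
    proof (rule reach_set_least)
      show "S \<subseteq> ?C" by (auto intro: reach_set.base)
      fix g u w assume g: "joins ?H g u w" "w \<in> ?C" "label ?H g \<in> ?C"
      have gG: "joins G g u w" using g(1) by (simp add: joins_contract)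
      have "label G g \<in> reach_set G S" using g(3) False by (auto split: if_splits)
      then show "u \<in> ?C" using reach_set.step[OF gG] reach_set.step[OF g(1)] g(2,3) by blast
    qed
    then have "card (reach_set ?H S) \<le> card (reach_set G S)"
      by (intro card_mono finR[OF SG(1)]) auto
    also have "\<dots> < 2 * card S" using G(2) SG(1) S(2) by (simp add: sparse_def)
    finally show ?thesis .
  qed
qed

section \<open>Induction along contractions\<close>

text \<open>Every edge has a partner completing it to a Rosebrock triple with its endpoints and
  label. This strengthens the induction hypothesis.\<close>

definition paired :: "('v, 'e) labeled_graph \<Rightarrow> bool" where
  "paired G \<longleftrightarrow> (\<forall>g p q. joins G g p q \<longrightarrow>
     (\<exists>h. joins G h q (label G g) \<and> label G h = p \<or> joins G h p (label G g) \<and> label G h = q))"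

text \<open>An end block is contracted. Pairedness of the contraction shows that no arc of
  \<open>G\<close> inside \<open>T\<close> is labeled \<open>x\<close> or \<open>z\<close>, so the
  block splits off as a summand.\<close>

lemma sparse_decomposes:
  "LOT G \<Longrightarrow> interior_reduced G \<Longrightarrow> sparse G \<Longrightarrow> card (verts G) > 1 \<Longrightarrow>
    paired G \<and> (\<exists>Gs. decomposes G Gs \<and> (\<forall>H \<in> set Gs. Rosebrock H))"
proof (induction "card (verts G)" arbitrary: G rule: less_induct)
  case less
  note G = less.prems(1-3)
  obtain T e f x y z where blk: "end_block G T e f x y z"
    using sparse_end_block[OF less.prems] by blast
  note b = end_blockD[OF blk] and a = end_block_arcs[OF blk]
  let ?H = "contract G T y" and ?R = "G\<lparr>verts := {x, y, z}, arcs := {e, f}\<rparr>"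
  note R = Rosebrock_end_block[OF G(1) blk] and H = LOT_contract[OF G(1) blk]
  have finT: "finite T" using LOT_finite[OF H] by simp
  \<comment> \<open>The edges \<open>e\<close> and \<open>f\<close> are partners of each
    other.\<close>
  have pair_ef: "\<exists>h. joins G h q (label G g) \<and> label G h = p \<or> joins G h p (label G g) \<and> label G h = q"
    if g: "joins G g p q" "g \<in> {e, f}" for g p q
  proof -
    have ends: "p = u \<and> q = w \<or> p = w \<and> q = u" if "joins G g u w" for u w
      using that g(1) by (auto simp: joins_def)
    note sym = joins_sym[OF b(6)]
    from b(8) show ?thesis
    proof
      assume f: "joins G f x z \<and> label G f = y"
      then show ?thesis
        using g(2) ends b(6,7) sym joins_sym[of G f x z] by (cases "g = e") auto
    next
      assume f: "joins G f y z \<and> label G f = x"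
      then show ?thesis
        using g(2) ends b(6,7) sym joins_sym[of G f y z] by (cases "g = e") auto
    qed
  qed
  show ?case
  \<comment> \<open>If \<open>T\<close> is a single vertex, the induction hypothesis does not apply
    to the contraction, and \<open>G\<close> is the Rosebrock LOT itself.\<close>
  proof (cases "T = {y}")
    case True
    have "arcs G = {e, f}"
    proof -
      have "tail G g \<noteq> head G g" if "g \<in> arcs G" for g
        using LOT_joins_neq[OF G(1), of g "tail G g" "head G g"] that by (simp add: joins_def)
      then have "\<not> (tail G g \<in> T \<and> head G g \<in> T)" if "g \<in> arcs G" for g
        using that True by (metis singletonD)
      then have "arcs G - {e, f} = {}" using a(4) by blast
      then show ?thesis using a(2,3) by blast
    qed
    moreover have "verts G = {x, y, z}" using b(5) True by auto
    ultimately have "?R = G" by simp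
    then have "Rosebrock G" using R by simp
    moreover have "paired G"
      unfolding paired_def
    proof (intro allI impI)
      fix g p q assume g: "joins G g p q"
      show "\<exists>h. joins G h q (label G g) \<and> label G h = p \<or> joins G h p (label G g) \<and> label G h = q"
        using pair_ef[OF g] joins_arc[OF g] \<open>arcs G = {e, f}\<close> by simp
    qed
    ultimately show ?thesis using decomposes.single[OF G(1)] by (intro conjI exI[of _ "[G]"]) auto
  next
    case False
    have "card (verts ?H) < card (verts G)"
      using b(2-5) finT by simp
    moreover have "{y} \<subset> T" using False b(1) by blast
    then have "card (verts ?H) > 1" using psubset_card_mono[OF finT, of "{y}"] by simp
    ultimately have IH: "paired ?H" "\<exists>Gs. decomposes ?H Gs \<and> (\<forall>H \<in> set Gs. Rosebrock H)"
      using less.hyps[OF _ H interior_reduced_contract[OF G blk] sparse_contract[OF G(1,3) blk]]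
      by blast+
    \<comment> \<open>Otherwise the partner of \<open>g\<close> in the contraction, read in \<open>G\<close>, leads from two vertices of
      the closed triple of \<open>g\<close> to \<open>y\<close>, which lies outside that triple.\<close>
    have lab: "label G g \<in> T" if gT: "joins G g p q" "p \<in> T" "q \<in> T" for g p q
    proof (rule ccontr)
      assume l: "label G g \<notin> T"
      have gH: "joins ?H g p q" and lH: "label ?H g = y" using gT l by (auto simp: joins_contract)
      have ne: "y \<noteq> p" "y \<noteq> q"
        using interior_reduced_joins[OF interior_reduced_contract[OF G blk] gH] lH by auto
      obtain h where "joins ?H h q y \<and> label ?H h = p \<or> joins ?H h p y \<and> label ?H h = q"
        using IH(1) gH lH unfolding paired_def by metis
      then have "joins G h q y \<and> label G h = p \<or> joins G h p y \<and> label G h = q"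
        using ne by (auto simp: joins_contract split: if_splits)
      then have "y \<in> {p, q, label G g}"
        using sparse_triple_closed[OF G gT(1), of h q y] sparse_triple_closed[OF G gT(1), of h p y] by auto
      then show False using ne l b(1) by auto
    qed
    have lab': "label G g \<in> T" if "g \<in> arcs G - {e, f}" for g
      using that a(4) lab[of g "tail G g" "head G g"] by (auto simp: joins_def)
    have "paired G"
      unfolding paired_def
    proof (intro allI impI)
      fix g p q assume g: "joins G g p q"
      show "\<exists>h. joins G h q (label G g) \<and> label G h = p \<or> joins G h p (label G g) \<and> label G h = q"
      proof (cases "g \<in> {e, f}")
        case True
        then show ?thesis using pair_ef[OF g] by blast
      next
        case False
        then have T: "p \<in> T" "q \<in> T" using b(9)[OF g] by auto
        then have "joins ?H g p q" using g by (simp add: joins_contract)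
        then obtain h where "joins ?H h q (label ?H g) \<and> label ?H h = p \<or>
            joins ?H h p (label ?H g) \<and> label ?H h = q"
          using IH(1) unfolding paired_def by metis
        \<comment> \<open>No label changes under contraction, so a partner found there is a partner
          in \<open>G\<close>.\<close>
        moreover have "label G h \<in> T" if "joins ?H h u w" for u w
          using that lab by (auto simp: joins_contract)
        ultimately show ?thesis using lab[OF g T] by (auto simp: joins_contract)
      qed
    qed
    moreover obtain Gs where Gs: "decomposes ?H Gs" "\<forall>H \<in> set Gs. Rosebrock H" using IH(2) by blast
    have "decomposes G (Gs @ [?R])"
      using decomposes.snoc[OF is_sum_end_block[OF G(1) blk lab'] Gs(1)] .
    moreover have "\<forall>H \<in> set (Gs @ [?R]). Rosebrock H" using Gs(2) R by auto
    ultimately show ?thesis by (intro conjI exI[of _ "Gs @ [?R]"])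
  qed
qed

section \<open>Complexity of sums\<close>

text \<open>This is the lower bound on \<open>cp\<close> without the minimum. Inclusion in place of
  equality avoids proving that reachable sets of a \<open>glue\<close> stay inside its
  vertices.\<close>

definition generator_bound :: "('v, 'e) labeled_graph \<Rightarrow> bool" where
  "generator_bound G \<longleftrightarrow>
     (\<forall>S \<subseteq> verts G. verts G \<subseteq> reach_set G S \<longrightarrow> card (verts G) + 1 \<le> 2 * card S)"

lemma generator_bound_iso:
  assumes "LOT_iso G H" "generator_bound H"
  shows "generator_bound G"
  unfolding generator_bound_def
proof (intro allI impI)
  fix S assume S: "S \<subseteq> verts G" "verts G \<subseteq> reach_set G S"
  obtain f g where f: "bij_betw f (verts G) (verts H)" and g: "bij_betw g (arcs G) (arcs H)"
    and fg: "\<forall>e \<in> arcs G. tail H (g e) = f (tail G e) \<and> head H (g e) = f (head G e) \<and>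
                      label H (g e) = f (label G e)"
    using assms(1) unfolding LOT_iso_def by metis
  have im: "f ` verts G = verts H" and inj: "inj_on f (verts G)"
    using f by (simp_all add: bij_betw_def)
  have "reach_set G S \<subseteq> {v. f v \<in> reach_set H (f ` S)}"
  proof (rule reach_set_least)
    show "S \<subseteq> {v. f v \<in> reach_set H (f ` S)}" by (auto intro: reach_set.base)
    fix e x y assume e: "joins G e x y" and
      y: "y \<in> {v. f v \<in> reach_set H (f ` S)}" "label G e \<in> {v. f v \<in> reach_set H (f ` S)}"
    have "g e \<in> arcs H" using bij_betwE[OF g] joins_arc[OF e] by simp
    then have "joins H (g e) (f x) (f y)" using e fg by (auto simp: joins_def)
    then have "f x \<in> reach_set H (f ` S)"
      by (rule reach_set.step) (use y fg joins_arc[OF e] in auto)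
    then show "x \<in> {v. f v \<in> reach_set H (f ` S)}" by simp
  qed
  then have "verts H \<subseteq> reach_set H (f ` S)" unfolding im[symmetric] using S(2) by blast
  moreover have "f ` S \<subseteq> verts H" using S(1) im by auto
  ultimately have "card (verts H) + 1 \<le> 2 * card (f ` S)"
    using assms(2) by (simp add: generator_bound_def)
  then show "card (verts G) + 1 \<le> 2 * card S"
    using bij_betw_same_card[OF f] card_image[OF inj_on_subset[OF inj S(1)]] by simp
qed

lemma joins_glue_Inl: "joins (glue G x H y) (Inl e) u w \<longleftrightarrow>
    (\<exists>u' w'. u = Inl u' \<and> w = Inl w' \<and> joins G e u' w')"
  by (auto simp: joins_def glue_def identify_def)

lemma joins_glue_Inr: "joins (glue G x H y) (Inr e) u w \<longleftrightarrow>
    (\<exists>u' w'. u = identify x y (Inr u') \<and> w = identify x y (Inr w') \<and> joins H e u' w')"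
  by (auto simp: joins_def glue_def)

lemma verts_glue:
  "x \<in> verts G \<Longrightarrow> verts (glue G x H y) = Inl ` verts G \<union> Inr ` (verts H - {y})"
  by (auto simp: glue_def identify_def image_iff)

lemma label_glue:
  "label (glue G x H y) (Inl e) = Inl (label G e)"
  "label (glue G x H y) (Inr f) = identify x y (Inr (label H f))"
  by (simp_all add: glue_def identify_def)

text \<open>Adding the two bounds exceeds the desired one by exactly 2: the second
  \<open>+ 1\<close> and the vertex counted twice. This matches the cost of one extra
  generator.\<close>

lemma generator_bound_glue:
  assumes fin: "finite (verts G)" "finite (verts H)"
    and bG: "generator_bound G" and bH: "generator_bound H"
    and x: "x \<in> verts G" and y: "y \<in> verts H"
  shows "generator_bound (glue G x H y)"
  unfolding generator_bound_def
proof (intro allI impI)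
  let ?K = "glue G x H y"
  fix S assume S: "S \<subseteq> verts ?K" "verts ?K \<subseteq> reach_set ?K S"
  define S1 where "S1 = {v \<in> verts G. Inl v \<in> S}"
  \<comment> \<open>The identified vertex, if it is in \<open>S\<close>, is counted in both
    \<open>S1\<close> and \<open>S2\<close>; hence the \<open>S2 - {y}\<close> in the
    cardinalities.\<close>
  define S2 where "S2 = {w \<in> verts H. identify x y (Inr w) \<in> S}"
  note V = verts_glue[OF x, of H y]
  have Seq: "S = Inl ` S1 \<union> Inr ` (S2 - {y})"
    using S(1) unfolding V S1_def S2_def by (auto simp: identify_def)
  have fS: "finite S1" "finite S2" using fin by (simp_all add: S1_def S2_def)
  have xy: "y \<in> S2 \<longleftrightarrow> x \<in> S1" using x y by (simp add: S1_def S2_def identify_def)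
  have cS: "card S = card S1 + card (S2 - {y})"
    unfolding Seq using fS by (subst card_Un_disjoint) (auto simp: card_image)
  have cV: "card (verts ?K) + 1 = card (verts G) + card (verts H)"
    unfolding V using fin y card_Suc_Diff1[OF fin(2) y]
    by (subst card_Un_disjoint) (auto simp: card_image)
  \<comment> \<open>If both sides agree on whether the identified vertex is reached, the union of
    their reachable sets is closed under steps of the sum and contains \<open>S\<close>, so it is
    everything.\<close>
  have key: "verts G \<subseteq> reach_set G A1 \<and> verts H \<subseteq> reach_set H A2"
    if A: "S1 \<subseteq> A1" "S2 \<subseteq> A2" and iff: "x \<in> reach_set G A1 \<longleftrightarrow> y \<in> reach_set H A2" for A1 A2
  proof -
    let ?C = "Inl ` reach_set G A1 \<union> Inr ` reach_set H A2"
    have C1: "Inl v \<in> ?C \<longleftrightarrow> v \<in> reach_set G A1" for v by auto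
    have C2: "identify x y (Inr w) \<in> ?C \<longleftrightarrow> w \<in> reach_set H A2" for w
      using iff by (auto simp: identify_def)
    have "reach_set ?K S \<subseteq> ?C"
    proof (rule reach_set_least)
      show "S \<subseteq> ?C"
        unfolding Seq using A reach_set_base[of A1 G] reach_set_base[of A2 H] by blast
      fix g u w assume g: "joins ?K g u w" "w \<in> ?C" "label ?K g \<in> ?C"
      show "u \<in> ?C"
      proof (cases g)
        case (Inl e)
        obtain u' w' where e: "u = Inl u'" "w = Inl w'" "joins G e u' w'"
          using g(1) unfolding Inl joins_glue_Inl by blast
        have "w' \<in> reach_set G A1" "label G e \<in> reach_set G A1"
          using g(2,3) by (auto simp: Inl e(2) label_glue)
        then show ?thesis unfolding e(1) C1 by (rule reach_set.step[OF e(3)])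
      next
        case (Inr e)
        obtain u' w' where e: "u = identify x y (Inr u')" "w = identify x y (Inr w')" "joins H e u' w'"
          using g(1) unfolding Inr joins_glue_Inr by blast
        have "w' \<in> reach_set H A2" "label H e \<in> reach_set H A2"
          using g(2,3) C2[of w'] C2[of "label H e"] by (simp_all only: Inr e(2) label_glue)
        then show ?thesis unfolding e(1) C2 by (rule reach_set.step[OF e(3)])
      qed
    qed
    then have sub: "verts ?K \<subseteq> ?C" using S(2) by blast
    have "v \<in> reach_set G A1" if "v \<in> verts G" for v
      using sub that C1 unfolding V by blast
    moreover have "identify x y (Inr w) \<in> verts ?K" if "w \<in> verts H" for w
      using that x unfolding V by (auto simp: identify_def)
    then have "w \<in> reach_set H A2" if "w \<in> verts H" for w
      using sub that C2 by blast
    ultimately show ?thesis by blast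
  qed
  have bG': "card (verts G) + 1 \<le> 2 * card A" if "A \<subseteq> verts G" "verts G \<subseteq> reach_set G A" for A
    using bG that by (simp add: generator_bound_def)
  have bH': "card (verts H) + 1 \<le> 2 * card A" if "A \<subseteq> verts H" "verts H \<subseteq> reach_set H A" for A
    using bH that by (simp add: generator_bound_def)
  have sub: "S1 \<subseteq> verts G" "S2 \<subseteq> verts H" "insert x S1 \<subseteq> verts G" "insert y S2 \<subseteq> verts H"
    using x y by (auto simp: S1_def S2_def)
  \<comment> \<open>The identified vertex is first reached from one side only, so one of \<open>S1\<close>, \<open>S2\<close> generates
    its side, and the other does so once the identified vertex is added.\<close>
  show "card (verts ?K) + 1 \<le> 2 * card S"
  proof (cases "x \<in> reach_set G S1")
    case True
    have "verts G \<subseteq> reach_set G S1 \<and> verts H \<subseteq> reach_set H (insert y S2)"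
      by (rule key) (use True reach_set_base[of "insert y S2" H] in auto)
    then have "card (verts G) + 1 \<le> 2 * card S1" "card (verts H) + 1 \<le> 2 * card (insert y S2)"
      using bG' bH' sub by blast+
    moreover have "card (insert y S2) = Suc (card (S2 - {y}))"
      using fS by (simp add: card.insert_remove)
    ultimately show ?thesis using cS cV by simp
  next
    case False
    show ?thesis
    proof (cases "y \<in> reach_set H S2")
      case True
      have "verts G \<subseteq> reach_set G (insert x S1) \<and> verts H \<subseteq> reach_set H S2"
        by (rule key) (use True reach_set_base[of "insert x S1" G] in auto)
      then have "card (verts G) + 1 \<le> 2 * card (insert x S1)" "card (verts H) + 1 \<le> 2 * card S2"
        using bG' bH' sub by blast+
      moreover have "x \<notin> S1" using False reach_set_base[of S1 G] by blast
      ultimately show ?thesis using cS cV fS xy by simp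
    next
      case False
      \<comment> \<open>Here both sides agree that the identified vertex is not reached, so
        \<open>key\<close> yields a contradiction.\<close>
      then have "verts G \<subseteq> reach_set G S1"
        using key[of S1 S2] \<open>x \<notin> reach_set G S1\<close> by blast
      then show ?thesis using x \<open>x \<notin> reach_set G S1\<close> by blast
    qed
  qed
qed

text \<open>With three vertices the claim is that two generators are needed, and one vertex reaches
  only itself.\<close>

lemma generator_bound_Rosebrock:
  assumes "Rosebrock G" shows "generator_bound G"
  unfolding generator_bound_def
proof (intro allI impI)
  fix S assume S: "S \<subseteq> verts G" "verts G \<subseteq> reach_set G S"
  obtain a b c e f where R: "distinct [a, b, c]" "verts G = {a, b, c}" "arcs G = {e, f}"
    "joins G e a b" "label G e = c" "joins G f b c" "label G f = a"
    using assms unfolding Rosebrock_def by blast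
  have "label G e \<notin> {tail G e, head G e}" "label G f \<notin> {tail G f, head G f}"
    using R(1,4-7) by (auto simp: joins_def)
  then have ir: "interior_reduced G"
    unfolding interior_reduced_def R(3) by blast
  have c3: "card (verts G) = 3" using R(1,2) by simp
  have fin: "finite (verts G)" "finite S" using R(2) S(1) finite_subset by auto
  have "\<not> card S \<le> 1"
  proof
    assume "card S \<le> 1"
    then have "verts G \<subseteq> S" using reach_set_small[OF ir _ fin(2)] S(2) by blast
    from card_mono[OF fin(2) this] show False using c3 \<open>card S \<le> 1\<close> by simp
  qed
  then show "card (verts G) + 1 \<le> 2 * card S" using c3 by simp
qed

lemma generator_bound_decomposes:
  "decomposes G Gs \<Longrightarrow> \<forall>H \<in> set Gs. Rosebrock H \<Longrightarrow> generator_bound G"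
proof (induction rule: decomposes.induct)
  case (single G)
  then show ?case by (simp add: generator_bound_Rosebrock)
next
  case (snoc G G' H Gs)
  obtain x y where xy: "x \<in> verts G'" "y \<in> verts H" "LOT_iso G (glue G' x H y)"
    and L: "LOT G'" "LOT H" using snoc.hyps(1) unfolding is_sum_def by blast
  have "generator_bound G'" "generator_bound H"
    using snoc.IH snoc.prems generator_bound_Rosebrock by auto
  from generator_bound_glue[OF LOT_finite[OF L(1)] LOT_finite[OF L(2)] this xy(1,2)]
  show ?case by (rule generator_bound_iso[OF xy(3)])
qed

text \<open>The bound \<open>m > 1\<close> excludes the single vertex, whose complexity 1 equals
  \<open>(m + 1) / 2\<close> although a decomposition has at least one factor and Rosebrock factors
  have three vertices.\<close>

theorem theorem4p4:
  fixes G :: "('v, 'e) labeled_graph" and m :: nat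
  assumes "LOT G"
    and "connected (digraph_of G)"
    and "interior_reduced G"
    and "card (verts G) = m"
    and "m > 1"
  shows "real (cp G) = (real m + 1) / 2 \<longleftrightarrow>
    (\<exists>Gs. decomposes G Gs \<and> (\<forall>H \<in> set Gs. Rosebrock H))"
proof
  assume "real (cp G) = (real m + 1) / 2"
  then have "real (2 * cp G) = real (m + 1)" by simp
  then have "card (verts G) < 2 * cp G" using assms(4) by (simp only: of_nat_eq_iff)
  then have "sparse G" by (rule cp_max_imp_sparse[OF assms(1,3)])
  then show "\<exists>Gs. decomposes G Gs \<and> (\<forall>H \<in> set Gs. Rosebrock H)"
    using sparse_decomposes[OF assms(1,3)] assms(4,5) by simp
next
  assume "\<exists>Gs. decomposes G Gs \<and> (\<forall>H \<in> set Gs. Rosebrock H)"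
  then have bound: "generator_bound G" using generator_bound_decomposes by metis
  obtain S where S: "S \<subseteq> verts G" "reachable_from G S" "card S = cp G"
    using cp_attained[OF assms(1)] by metis
  have "m + 1 \<le> 2 * cp G"
    using bound S assms(4) by (auto simp: generator_bound_def reachable_from_def)
  moreover have "2 * cp G \<le> m + 1" using cp_upper_bound[OF assms(1,3)] assms(4) by simp
  ultimately have "m + 1 = 2 * cp G" by simp
  then have "real m + 1 = 2 * real (cp G)" by linarith
  then show "real (cp G) = (real m + 1) / 2" by simp
qed

end
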